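(* Let $n, m, N \ge 1$ be integers, let $\bar{\mathbf{x}} \in \mathbb{R}^n$ be a prior state estimate, let $\bar P \in \mathbb{R}^{n\times n}$ be a (prior) covariance matrix, let $H \in \mathbb{R}^{m\times n}$ be the matrix of a linear measurement of the state (measurement function $\mathbf{x}\mapsto H\mathbf{x}$), let $R \in \mathbb{R}^{m\times m}$ be the symmetric positive definite measurement noise covariance matrix, and let $\mathbf{y} \in \mathbb{R}^m$ be the measurement. Define $\mathbf{x}^{(0)} = \bar{\mathbf{x}}$, $P^{(0)} = \bar P$ and, for $1 \le i \le N$, $$K^{(i)} = P^{(i-1)}H^T\left(H P^{(i-1)}H^T + N R\right)^{-1},$$ $$\mathbf{x}^{(i)} = \mathbf{x}^{(i-1)} + K^{(i)}\left(\mathbf{y} - H\mathbf{x}^{(i-1)}\right), \qquad P^{(i)} = \left(I - K^{(i)}H\right)P^{(i-1)}.$$ Then the $N$th iterative state update is exactly equal to the Kalman state update, i.e. $\mathbf{x}^{(N)} = \hat{\mathbf{x}}$, where $$\hat{\mathbf{x}} = \bar{\mathbf{x}} + K\left(\mathbf{y} - H\bar{\mathbf{x}}\right), \qquad K = \hat P H^T R^{-1},$$ and $\hat P$ is the Kalman-updated covariance $$\hat P = \left(I - \bar P H^T\left(H\bar P H^T + R\right)^{-1}H\right)\bar P.$$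
   Context: All matrices are real and $I$ denotes the $n\times n$ identity matrix. A covariance matrix is a symmetric positive semidefinite matrix. The matrix $K = \hat P H^T R^{-1}$ is the Kalman gain of a single Kalman update expressed in terms of the updated covariance $\hat P$. The recursion performs $N$ successive Kalman updates of state and covariance, all with the same measurement $\mathbf{y}$ and with inflated measurement noise covariance $NR$. *)

theory Defs
  imports "HOL-Analysis.Analysis"
begin

definition symmetric_matrix :: "real^'n^'n \<Rightarrow> bool" where
  "symmetric_matrix A \<longleftrightarrow> transpose A = A"

definition positive_semidefinite :: "real^'n^'n \<Rightarrow> bool" where
  "positive_semidefinite A \<longleftrightarrow> (\<forall>v. 0 \<le> v \<bullet> (A *v v))"

definition positive_definite :: "real^'n^'n \<Rightarrow> bool" where
  "positive_definite A \<longleftrightarrow> (\<forall>v. v \<noteq> 0 \<longrightarrow> 0 < v \<bullet> (A *v v))"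

definition covariance_matrix :: "real^'n^'n \<Rightarrow> bool" where
  "covariance_matrix P \<longleftrightarrow> symmetric_matrix P \<and> positive_semidefinite P"

(* P is the covariance before the update, H the measurement matrix and S the
   measurement noise covariance.  matrix_inv is unspecified on singular matrices,
   but if P is symmetric positive semidefinite and S is symmetric positive
   definite, then the matrix inverted here is positive definite. *)
definition kalman_gain :: "real^'n^'n \<Rightarrow> real^'n^'m \<Rightarrow> real^'m^'m \<Rightarrow> real^'m^'n" where
  "kalman_gain P H S = P ** transpose H ** matrix_inv (H ** P ** transpose H + S)"

definition kalman_cov :: "real^'n^'n \<Rightarrow> real^'n^'m \<Rightarrow> real^'m^'m \<Rightarrow> real^'n^'n" where
  "kalman_cov P H S = (mat 1 - kalman_gain P H S ** H) ** P"

(* The gain in terms of the updated covariance Phat; H and R as above. *)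
definition posterior_gain :: "real^'n^'n \<Rightarrow> real^'n^'m \<Rightarrow> real^'m^'m \<Rightarrow> real^'m^'n" where
  "posterior_gain Phat H R = Phat ** transpose H ** matrix_inv R"

definition kalman_state ::
  "real^'n^'n \<Rightarrow> real^'n^'m \<Rightarrow> real^'m^'m \<Rightarrow> real^'m \<Rightarrow> real^'n \<Rightarrow> real^'n" where
  "kalman_state P H R y x =
     x + posterior_gain (kalman_cov P H R) H R *v (y - H *v x)"

(* The total number N of iterations enters every step through the inflated
   noise N R, so it is a parameter separate from the step index i. *)
primrec iter_cov ::
  "nat \<Rightarrow> real^'n^'n \<Rightarrow> real^'n^'m \<Rightarrow> real^'m^'m \<Rightarrow> nat \<Rightarrow> real^'n^'n" where
  "iter_cov N P H R 0 = P"
| "iter_cov N P H R (Suc i) = kalman_cov (iter_cov N P H R i) H (real N *\<^sub>R R)"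

primrec iter_state ::
  "nat \<Rightarrow> real^'n^'n \<Rightarrow> real^'n^'m \<Rightarrow> real^'m^'m \<Rightarrow> real^'m \<Rightarrow> real^'n \<Rightarrow> nat \<Rightarrow> real^'n" where
  "iter_state N P H R y x 0 = x"
| "iter_state N P H R y x (Suc i) =
     iter_state N P H R y x i +
     kalman_gain (iter_cov N P H R i) H (real N *\<^sub>R R) *v (y - H *v iter_state N P H R y x i)"

end

theory Submission
  imports Defs
begin

text \<open>
  With \<open>S = N R\<close> and \<open>G = H P H\<^sup>T\<close>, the iterates have a closed form in terms of
  \<open>W\<^sub>i = (i G + S)\<^sup>-\<^sup>1\<close>: the covariance is \<open>P - i P H\<^sup>T W\<^sub>i H P\<close>, the gain of the next step
  is \<open>P H\<^sup>T W\<^sub>i\<^sub>+\<^sub>1\<close>, and the state is \<open>x + i P H\<^sup>T W\<^sub>i (y - H x)\<close>. Both inductions rest on the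
  resolvent identity \<open>i W\<^sub>i + W\<^sub>i\<^sub>+\<^sub>1 S W\<^sub>i = (i + 1) W\<^sub>i\<^sub>+\<^sub>1\<close>. For \<open>i = N\<close> the factor \<open>N\<close> cancels
  because \<open>N G + N R = N (G + R)\<close>.
\<close>

lemma matrix_add_rdistrib:
  fixes A B :: "real^'n^'m" and C :: "real^'k^'n"
  shows "(A + B) ** C = A ** C + B ** C"
  by (vector matrix_matrix_mult_def sum.distrib[symmetric] field_simps)

lemma matrix_sub_ldistrib:
  fixes A :: "real^'n^'m" and B C :: "real^'k^'n"
  shows "A ** (B - C) = A ** B - A ** C"
  by (vector matrix_matrix_mult_def sum_subtractf[symmetric] field_simps)

lemma matrix_sub_rdistrib:
  fixes A B :: "real^'n^'m" and C :: "real^'k^'n"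
  shows "(A - B) ** C = A ** C - B ** C"
  by (vector matrix_matrix_mult_def sum_subtractf[symmetric] field_simps)

lemmas matrix_ring_simps = matrix_add_ldistrib matrix_add_rdistrib matrix_sub_ldistrib
  matrix_sub_rdistrib matrix_scalar_ac scalar_matrix_assoc[symmetric] matrix_mul_assoc[symmetric]

lemma invertible_matrix_inv:
  fixes A :: "real^'n^'n"
  assumes "invertible A"
  shows "A ** matrix_inv A = mat 1" "matrix_inv A ** A = mat 1"
  using someI_ex[OF assms[unfolded invertible_def]] by (simp_all add: matrix_inv_def)

lemma matrix_inv_eqI:
  fixes A B :: "real^'n^'n"
  assumes "A ** B = mat 1"
  shows "matrix_inv A = B"
proof -
  have "invertible A"
    using assms matrix_left_right_inverse by (auto simp: invertible_def)
  then have "matrix_inv A ** A ** B = B"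
    by (simp add: invertible_matrix_inv)
  then show ?thesis
    by (simp add: matrix_mul_assoc[symmetric] assms)
qed

lemma positive_definite_imp_invertible:
  assumes "positive_definite A"
  shows "invertible A"
proof -
  have "\<forall>x. A *v x = 0 \<longrightarrow> x = 0"
    using assms by (metis inner_zero_right less_irrefl positive_definite_def)
  then show ?thesis
    by (simp add: invertible_left_inverse matrix_left_invertible_ker)
qed

lemma positive_definite_scaleR:
  assumes "0 < c" "positive_definite A"
  shows "positive_definite (c *\<^sub>R A)"
  using assms by (simp add: positive_definite_def scaleR_matrix_vector_assoc[symmetric])

text \<open>Since \<open>v \<bullet> (H P H\<^sup>T v)\<close> is the form of \<open>P\<close> at
  \<open>H\<^sup>T v\<close>, the first summand is semidefinite, and adding the definite
  \<open>S\<close> makes the sum definite.\<close>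

lemma invertible_scaled_innovation:
  fixes P :: "real^'n^'n" and H :: "real^'n^'m"
  assumes "positive_semidefinite P" "positive_definite S" "0 \<le> t"
  shows "invertible (t *\<^sub>R (H ** P ** transpose H) + S)"
proof (rule positive_definite_imp_invertible)
  have "0 \<le> v \<bullet> ((H ** P ** transpose H) *v v)" for v
  proof -
    have "v \<bullet> ((H ** P ** transpose H) *v v) = (transpose H *v v) \<bullet> (P *v (transpose H *v v))"
      by (simp add: matrix_vector_mul_assoc[symmetric] dot_lmul_matrix[symmetric])
    then show ?thesis
      using assms(1) by (simp add: positive_semidefinite_def)
  qed
  then show "positive_definite (t *\<^sub>R (H ** P ** transpose H) + S)"
    using assms(2,3)
    by (auto simp: positive_definite_def matrix_vector_mult_add_rdistrib inner_add_right
        scaleR_matrix_vector_assoc[symmetric] intro!: add_nonneg_pos)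
qed

text \<open>For \<open>t > 0\<close>, \<open>t\<close> times this is the Kalman gain for noise
  \<open>S / t\<close>: absorbing \<open>t\<close> measurements of noise \<open>S\<close> amounts to
  one of noise \<open>S / t\<close>. At \<open>t = 1\<close> it is the ordinary Kalman gain.\<close>

definition scaled_gain :: "real \<Rightarrow> real^'n^'n \<Rightarrow> real^'n^'m \<Rightarrow> real^'m^'m \<Rightarrow> real^'m^'n" where
  "scaled_gain t P H S =
     P ** transpose H ** matrix_inv (t *\<^sub>R (H ** P ** transpose H) + S)"

lemma scaled_gain_step:
  fixes P :: "real^'n^'n" and H :: "real^'n^'m"
  assumes P: "positive_semidefinite P" and S: "positive_definite S" and t: "0 \<le> t"
  shows kalman_gain_scaled:
      "kalman_gain (P - t *\<^sub>R (scaled_gain t P H S ** H ** P)) H S = scaled_gain (t + 1) P H S"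
      (is ?gain)
    and scaled_gain_recurrence:
      "t *\<^sub>R scaled_gain t P H S + scaled_gain (t + 1) P H S
         - t *\<^sub>R (scaled_gain (t + 1) P H S ** H ** scaled_gain t P H S)
       = (t + 1) *\<^sub>R scaled_gain (t + 1) P H S" (is ?rec)
    and posterior_gain_scaled:
      "posterior_gain (P - t *\<^sub>R (scaled_gain t P H S ** H ** P)) H S = scaled_gain t P H S"
      (is ?post)
proof -
  define C where "C = P ** transpose H"
  define G where "G = H ** C"
  define A where "A = t *\<^sub>R G + S"
  define B where "B = (t + 1) *\<^sub>R G + S"
  define V where "V = matrix_inv A"
  define W where "W = matrix_inv B"
  define Q where "Q = P - t *\<^sub>R (scaled_gain t P H S ** H ** P)"
  have G': "H ** P ** transpose H = G"
    by (simp add: G_def C_def matrix_mul_assoc)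
  have gV: "scaled_gain t P H S = C ** V" and gW: "scaled_gain (t + 1) P H S = C ** W"
    by (simp_all add: scaled_gain_def G' V_def W_def A_def B_def C_def)
  have "invertible A" "invertible B" "invertible S"
    using invertible_scaled_innovation[OF P S, of _ H] t positive_definite_imp_invertible[OF S]
    by (auto simp: A_def B_def G')
  then have AV: "A ** V = mat 1" and VA: "V ** A = mat 1"
    and BW: "B ** W = mat 1" and WB: "W ** B = mat 1"
    and S1: "S ** matrix_inv S = mat 1"
    by (simp_all add: invertible_matrix_inv V_def W_def)
  \<comment> \<open>Solving \<open>V A = 1\<close> for the \<open>S\<close> part of \<open>A\<close>
    produces exactly the factor that the covariance correction leaves in
    \<open>Q H\<^sup>T\<close>.\<close>
  have VS: "V ** S = mat 1 - t *\<^sub>R (V ** G)"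
    using VA by (simp add: A_def matrix_ring_simps algebra_simps)
  have QHt: "Q ** transpose H = C ** V ** S"
  proof -
    have "Q ** transpose H = C ** (mat 1 - t *\<^sub>R (V ** G))"
      by (simp add: Q_def gV G_def C_def matrix_ring_simps)
    then show ?thesis
      by (simp add: VS[symmetric] matrix_mul_assoc)
  qed
  \<comment> \<open>Writing \<open>S\<close> as \<open>A V S\<close> exposes the common factor
    \<open>V S\<close>, and \<open>G + A = B\<close> advances \<open>t\<close> to
    \<open>t + 1\<close>.\<close>
  have "H ** Q ** transpose H + S = G ** V ** S + A ** V ** S"
    by (simp add: AV QHt G_def matrix_mul_assoc[symmetric])
  also have "\<dots> = B ** V ** S"
    by (simp add: A_def B_def matrix_ring_simps algebra_simps)
  finally have innov: "H ** Q ** transpose H + S = B ** V ** S" .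
  \<comment> \<open>The candidate inverse takes the factor inverses in reverse order, where
    \<open>V\<close> has inverse \<open>A\<close> and \<open>B\<close> has inverse
    \<open>W\<close>.\<close>
  have "B ** V ** S ** (matrix_inv S ** A ** W) = B ** (V ** (S ** matrix_inv S) ** A) ** W"
    by (simp add: matrix_mul_assoc)
  also have "\<dots> = mat 1"
    by (simp add: S1 VA BW)
  finally have inv: "matrix_inv (B ** V ** S) = matrix_inv S ** A ** W"
    by (rule matrix_inv_eqI)
  have "kalman_gain Q H S = C ** (V ** (S ** matrix_inv S) ** A) ** W"
    by (simp add: kalman_gain_def innov inv QHt matrix_mul_assoc)
  then show ?gain
    by (simp add: S1 VA gW Q_def)
  have "posterior_gain Q H S = C ** V ** (S ** matrix_inv S)"
    by (simp add: posterior_gain_def QHt matrix_mul_assoc)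
  then show ?post
    by (simp add: S1 gV Q_def)
  \<comment> \<open>By \<open>A V = 1\<close>, \<open>W - t W G V\<close> is \<open>W S V\<close>,
    so this is the resolvent identity. With \<open>W\<close> and \<open>V\<close> pulled out on
    either side, the middle factor is \<open>t B + A - t G = (t + 1) A\<close>.\<close>
  have "t *\<^sub>R V + W - t *\<^sub>R (W ** G ** V) = t *\<^sub>R (W ** B ** V) + W ** (A ** V) - t *\<^sub>R (W ** G ** V)"
    by (simp add: WB AV)
  also have "\<dots> = W ** ((t + 1) *\<^sub>R A) ** V"
    by (simp add: A_def B_def matrix_ring_simps algebra_simps)
  also have "\<dots> = (t + 1) *\<^sub>R (W ** (A ** V))"
    by (simp add: matrix_ring_simps)
  also have "\<dots> = (t + 1) *\<^sub>R W"
    by (simp add: AV)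
  finally have "C ** (t *\<^sub>R V + W - t *\<^sub>R (W ** G ** V)) = C ** ((t + 1) *\<^sub>R W)"
    by simp
  then show ?rec
    by (simp add: gV gW G_def matrix_ring_simps)
qed

text \<open>Expanding \<open>(1 - U' H) (P - t U H P)\<close> collects, in front of
  \<open>H P\<close>, the left side of \<open>scaled_gain_recurrence\<close>.\<close>

lemma kalman_cov_scaled:
  fixes P :: "real^'n^'n" and H :: "real^'n^'m"
  assumes "positive_semidefinite P" "positive_definite S" "0 \<le> t"
  shows "kalman_cov (P - t *\<^sub>R (scaled_gain t P H S ** H ** P)) H S
    = P - (t + 1) *\<^sub>R (scaled_gain (t + 1) P H S ** H ** P)"
proof -
  let ?U = "scaled_gain t P H S" and ?U' = "scaled_gain (t + 1) P H S"
  have "kalman_cov (P - t *\<^sub>R (?U ** H ** P)) H S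
      = P - (t *\<^sub>R ?U + ?U' - t *\<^sub>R (?U' ** H ** ?U)) ** H ** P"
    unfolding kalman_cov_def kalman_gain_scaled[OF assms]
    by (simp add: matrix_ring_simps algebra_simps)
  then show ?thesis
    unfolding scaled_gain_recurrence[OF assms] by (simp add: scalar_matrix_assoc)
qed

lemma iter_cov_closed_form:
  fixes P :: "real^'n^'n" and H :: "real^'n^'m"
  assumes "positive_semidefinite P" "positive_definite (real N *\<^sub>R R)"
  shows "iter_cov N P H R i
    = P - real i *\<^sub>R (scaled_gain (real i) P H (real N *\<^sub>R R) ** H ** P)"
  by (induction i) (simp_all add: kalman_cov_scaled[OF assms] add.commute)

lemma iter_state_closed_form:
  fixes P :: "real^'n^'n" and H :: "real^'n^'m"
  assumes "positive_semidefinite P" "positive_definite (real N *\<^sub>R R)"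
  shows "iter_state N P H R y x i
    = x + real i *\<^sub>R (scaled_gain (real i) P H (real N *\<^sub>R R) *v (y - H *v x))"
proof (induction i)
  case 0
  show ?case by simp
next
  case (Suc i)
  let ?t = "real i" and ?S = "real N *\<^sub>R R" and ?z = "y - H *v x"
  let ?U = "scaled_gain ?t P H ?S" and ?U' = "scaled_gain (?t + 1) P H ?S"
  have "iter_state N P H R y x (Suc i)
      = x + ?t *\<^sub>R (?U *v ?z) + ?U' *v (y - H *v (x + ?t *\<^sub>R (?U *v ?z)))"
    by (simp add: Suc.IH iter_cov_closed_form[OF assms] kalman_gain_scaled[OF assms])
  \<comment> \<open>The current residual is \<open>z - t H U z\<close>, so the combination of gains
    from the covariance update reappears, now acting on the initial residual
    \<open>z\<close>.\<close>
  also have "\<dots> = x + (?t *\<^sub>R ?U + ?U' - ?t *\<^sub>R (?U' ** H ** ?U)) *v ?z"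
  proof -
    have "y - H *v (x + ?t *\<^sub>R (?U *v ?z)) = ?z - ?t *\<^sub>R (H *v (?U *v ?z))"
      by (simp add: matrix_vector_right_distrib matrix_vector_mult_scaleR)
    then show ?thesis
      \<comment> \<open>The distributivity rule is instantiated so that the difference inside
        \<open>z\<close> itself is not split.\<close>
      by (simp only: matrix_vector_mult_add_rdistrib matrix_vector_mult_diff_rdistrib
          matrix_vector_mult_diff_distrib[of ?U' ?z] matrix_vector_mult_scaleR
          scaleR_matrix_vector_assoc[symmetric] matrix_vector_mul_assoc[symmetric])
        (simp add: algebra_simps)
  qed
  also have "\<dots> = x + (?t + 1) *\<^sub>R (?U' *v ?z)"
    by (simp only: scaled_gain_recurrence[OF assms of_nat_0_le_iff]
        scaleR_matrix_vector_assoc)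
  finally show ?case
    by (simp add: add.commute)
qed

lemma scaled_gain_scaleR:
  fixes P :: "real^'n^'n" and H :: "real^'n^'m"
  assumes P: "positive_semidefinite P" and R: "positive_definite R" and "0 < c"
  shows "c *\<^sub>R scaled_gain c P H (c *\<^sub>R R) = scaled_gain 1 P H R"
proof -
  let ?A = "H ** P ** transpose H + R"
  have "?A ** matrix_inv ?A = mat 1"
    using invertible_scaled_innovation[OF P R, of 1 H] by (simp add: invertible_matrix_inv)
  \<comment> \<open>Scaling the noise by \<open>c\<close> as well makes the whole innovation
    \<open>c\<close> times \<open>?A\<close>; the resulting \<open>1 / c\<close> cancels the outer
    factor.\<close>
  then have "(c *\<^sub>R ?A) ** ((1 / c) *\<^sub>R matrix_inv ?A) = mat 1"
    using \<open>0 < c\<close> by (simp add: matrix_scalar_ac scalar_matrix_assoc[symmetric])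
  then have "matrix_inv (c *\<^sub>R ?A) = (1 / c) *\<^sub>R matrix_inv ?A"
    by (rule matrix_inv_eqI)
  then show ?thesis
    using \<open>0 < c\<close>
    by (simp add: scaled_gain_def scaleR_add_right matrix_scalar_ac scalar_matrix_assoc[symmetric])
qed

theorem theorem2p2:
  fixes N :: nat
    and xbar :: "real^'n"
    and Pbar :: "real^'n^'n"
    and H :: "real^'n^'m"
    and R :: "real^'m^'m"
    and y :: "real^'m"
  assumes "1 \<le> N"
    and "covariance_matrix Pbar"
    and "symmetric_matrix R"
    and "positive_definite R"
  shows "iter_state N Pbar H R y xbar N = kalman_state Pbar H R y xbar"
proof -
  have P: "positive_semidefinite Pbar" and N: "0 < real N"
    using assms by (simp_all add: covariance_matrix_def)
  note R = \<open>positive_definite R\<close>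
  have "iter_state N Pbar H R y xbar N = xbar + scaled_gain 1 Pbar H R *v (y - H *v xbar)"
    using iter_state_closed_form[OF P positive_definite_scaleR[OF N R]]
    by (simp add: scaleR_matrix_vector_assoc scaled_gain_scaleR[OF P R N])
  \<comment> \<open>At \<open>t = 0\<close> the correction vanishes, so the general step becomes a
    single update from \<open>Pbar\<close> with noise \<open>R\<close>.\<close>
  moreover have "kalman_cov Pbar H R = Pbar - scaled_gain 1 Pbar H R ** H ** Pbar"
    using kalman_cov_scaled[OF P R, of 0 H] by simp
  \<comment> \<open>At \<open>t = 1\<close>, the gain built from the updated covariance is the same
    \<open>scaled_gain 1\<close> that the iteration reaches.\<close>
  ultimately show ?thesis
    using posterior_gain_scaled[OF P R, of 1 H] by (simp add: kalman_state_def)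
qed

end
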